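(* Let $X$, $Y$ be (real or complex) Banach spaces, $\Omega\subseteq X$ an open set and $F:\Omega\to Y$ a continuously differentiable function. Let $x_*\in\Omega$, $R>0$ and $\kappa:=\sup\{t\in[0,R): B(x_*,t)\subset\Omega\}$. Suppose that $F(x_* )=0$, that $F'(x_* )$ is invertible, and that there exists a positive integrable function $L:[0,R)\to\mathbb{R}$ such that $$\left\|F'(x_* )^{-1}\left[F'(x)-F'(x_*+\tau(x-x_* ))\right]\right\|\leq\int_{\tau\|x-x_*\|}^{\|x-x_*\|}L(u)\,du$$ for all $\tau\in[0,1]$ and $x\in B(x_*,\kappa)$. Let $\bar\nu>0$, $\bar\rho>0$ and $\bar r>0$ be the constants defined by $$\bar\nu:=\sup\left\{t\in[0,R):\int_0^tL(u)\,du-1<0\right\},$$ $$\bar\rho:=\sup\left\{\delta\in(0,\bar\nu):\ \frac{\int_0^tL(u)u\,du}{t\left(1-\int_0^tL(u)\,du\right)}<1\ \text{ for all } t\in(0,\delta)\right\},\qquad \bar r:=\min\{\kappa,\bar\rho\}.$$ Then for every starting point $x_0\in B(x_*,\bar r)\setminus\{x_*\}$ and $t_0=\|x_0-x_*\|$, the sequences $$x_{k+1}=x_k-F'(x_k)^{-1}F(x_k),\qquad t_{k+1}=\frac{\int_0^{t_k}L(u)u\,du}{1-\int_0^{t_k}L(u)\,du},\qquad k=0,1,\ldots,$$ are well defined; $\{t_k\}$ is strictly decreasing, is contained in $(0,\bar r)$ and converges to $0$; $\{x_k\}$ is contained in $B(x_*,\bar r)$ and converges to $x_*$, which is the unique zero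 of $F$ in $B(x_*,\bar\sigma)$, where $$\bar\sigma:=\sup\left\{t\in(0,\kappa):\int_0^tL(u)(t-u)\,du-t<0\right\};$$ and $$\lim_{k\to\infty}\frac{t_{k+1}}{t_k}=0,\qquad \lim_{k\to\infty}\frac{\|x_{k+1}-x_*\|}{\|x_k-x_*\|}=0.$$ Moreover, if $$\frac{\int_0^{\bar\rho}L(u)u\,du}{\bar\rho\left(1-\int_0^{\bar\rho}L(u)\,du\right)}=1$$ and $\bar\rho<\kappa$, then $\bar r=\bar\rho$ is the best possible convergence radius. If, additionally, for a given $0\leq p\leq1$, the function $(0,\bar\nu)\ni t\mapsto t^{1-p}L(t)$ is nondecreasing, then the sequence $\{t_{k+1}/t_k^{p+1}\}$ is strictly decreasing and $$\|x_{k+1}-x_*\|\leq\big[t_{k+1}/t_k^{p+1}\big]\,\|x_k-x_*\|^{p+1},\qquad k=0,1,\ldots.$$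
   Context: $B(x,\delta)=\{y\in X:\|x-y\|<\delta\}$ is the open ball. $F'(x):X\to Y$ denotes the Fréchet derivative of $F$ at $x$ (a bounded linear map). "Well defined" means that at each step $x_k\in\Omega$ with $F'(x_k)$ invertible, and $t_k\in[0,R)$ with $1-\int_0^{t_k}L(u)\,du\neq0$. In the limit of $\|x_{k+1}-x_*\|/\|x_k-x_*\|$, the quotient is read as $0$ if $x_k=x_*$. "$\bar r=\bar\rho$ is the best possible convergence radius" means that, for the given $R$, $L$ and $\kappa$, no number $r'>\bar\rho$ can replace $\bar\rho$: for every $r'>\bar\rho$ there exist $(X,Y,\Omega,F,x_* )$ satisfying the hypotheses with these same $R$, $L$, $\kappa$, and a starting point $x_0\in\Omega$ with $0<\|x_0-x_*\|<r'$, such that Newton's method started at $x_0$ fails to produce a well defined sequence converging to $x_*$. *)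

theory Defs
  imports "HOL-Analysis.Analysis"
begin

definition blinfun_invertible ::
    "('a::real_normed_vector \<Rightarrow>\<^sub>L 'b::real_normed_vector) \<Rightarrow> bool"
  where "blinfun_invertible A \<longleftrightarrow>
    (\<exists>B. A o\<^sub>L B = id_blinfun \<and> B o\<^sub>L A = id_blinfun)"

(* Unspecified unless A is invertible. *)
definition blinfun_inverse ::
    "('a::real_normed_vector \<Rightarrow>\<^sub>L 'b::real_normed_vector) \<Rightarrow> ('b \<Rightarrow>\<^sub>L 'a)"
  where "blinfun_inverse A =
    (THE B. A o\<^sub>L B = id_blinfun \<and> B o\<^sub>L A = id_blinfun)"

(* F and F' are total functions, but only their values on \<Omega> are constrained; as \<Omega> is open,
   F' is determined there by F.  A complex Banach space enters through its underlying real one: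
   restricting scalars changes neither the norm, nor the derivative as a map, nor invertibility. *)
definition newton_setting ::
    "'a::banach set \<Rightarrow> ('a \<Rightarrow> 'b::banach) \<Rightarrow> ('a \<Rightarrow> 'a \<Rightarrow>\<^sub>L 'b) \<Rightarrow> 'a \<Rightarrow>
     real \<Rightarrow> real \<Rightarrow> (real \<Rightarrow> real) \<Rightarrow> bool"
  where "newton_setting \<Omega> F F' xs R \<kappa> L \<longleftrightarrow>
    open \<Omega> \<and>
    (\<forall>x\<in>\<Omega>. (F has_derivative blinfun_apply (F' x)) (at x)) \<and>
    continuous_on \<Omega> F' \<and>
    xs \<in> \<Omega> \<and>
    R > 0 \<and>
    \<kappa> = Sup {t \<in> {0..<R}. ball xs t \<subseteq> \<Omega>} \<and>
    F xs = 0 \<and>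
    blinfun_invertible (F' xs) \<and>
    (\<forall>u\<in>{0..<R}. L u > 0) \<and>
    L absolutely_integrable_on {0..<R} \<and>
    (\<forall>\<tau>\<in>{0..1}. \<forall>x\<in>ball xs \<kappa>.
       norm (blinfun_inverse (F' xs) o\<^sub>L (F' x - F' (xs + \<tau> *\<^sub>R (x - xs))))
         \<le> integral {\<tau> * norm (x - xs)..norm (x - xs)} L)"

primrec newton_seq ::
    "('a::banach \<Rightarrow> 'b::banach) \<Rightarrow> ('a \<Rightarrow> 'a \<Rightarrow>\<^sub>L 'b) \<Rightarrow> 'a \<Rightarrow> nat \<Rightarrow> 'a"
  where
    "newton_seq F F' x0 0 = x0"
  | "newton_seq F F' x0 (Suc k) =
       newton_seq F F' x0 k -
       blinfun_inverse (F' (newton_seq F F' x0 k)) (F (newton_seq F F' x0 k))"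

definition newton_well_defined ::
    "'a::banach set \<Rightarrow> ('a \<Rightarrow> 'b::banach) \<Rightarrow> ('a \<Rightarrow> 'a \<Rightarrow>\<^sub>L 'b) \<Rightarrow> 'a \<Rightarrow> bool"
  where "newton_well_defined \<Omega> F F' x0 \<longleftrightarrow>
    (\<forall>k. newton_seq F F' x0 k \<in> \<Omega> \<and> blinfun_invertible (F' (newton_seq F F' x0 k)))"

primrec scalar_seq :: "(real \<Rightarrow> real) \<Rightarrow> real \<Rightarrow> nat \<Rightarrow> real"
  where
    "scalar_seq L t0 0 = t0"
  | "scalar_seq L t0 (Suc k) =
       integral {0..scalar_seq L t0 k} (\<lambda>u. L u * u) /
       (1 - integral {0..scalar_seq L t0 k} L)"

definition scalar_well_defined :: "real \<Rightarrow> (real \<Rightarrow> real) \<Rightarrow> real \<Rightarrow> bool"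
  where "scalar_well_defined R L t0 \<longleftrightarrow>
    (\<forall>k. scalar_seq L t0 k \<in> {0..<R} \<and> 1 - integral {0..scalar_seq L t0 k} L \<noteq> 0)"

(* No number greater than \<rho> is a convergence radius for all problems sharing R, \<kappa> and L.
   HOL cannot quantify over the spaces X and Y existentially; the counterexamples are required
   on the real line, which implies the statement with arbitrary X and Y. *)
definition no_larger_convergence_radius ::
    "real \<Rightarrow> real \<Rightarrow> (real \<Rightarrow> real) \<Rightarrow> real \<Rightarrow> bool"
  where "no_larger_convergence_radius R \<kappa> L \<rho> \<longleftrightarrow>
    (\<forall>r'>\<rho>. \<exists>(\<Omega>::real set) (F::real \<Rightarrow> real) (F'::real \<Rightarrow> real \<Rightarrow>\<^sub>L real) xs x0.
       newton_setting \<Omega> F F' xs R \<kappa> L \<and>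
       x0 \<in> \<Omega> \<and> 0 < norm (x0 - xs) \<and> norm (x0 - xs) < r' \<and>
       \<not> (newton_well_defined \<Omega> F F' x0 \<and> newton_seq F F' x0 \<longlonglongrightarrow> xs))"

end

theory Submission
  imports Defs
begin

text \<open>
  Write \<open>mass t\<close> for the integral of \<open>L u\<close> over \<open>[0, t]\<close> and \<open>moment t\<close> for that of \<open>L u * u\<close>.
  The hypothesis on \<open>F'\<close> compares \<open>F\<close>, seen from the zero \<open>xs\<close>, with a scalar model.  If \<open>x\<close> lies at
  distance \<open>s\<close> from \<open>xs\<close>, then \<open>F' xs\<inverse> \<circ> F' x\<close> differs from the identity by at most \<open>mass s < 1\<close>, so
  \<open>F' x\<close> is invertible and \<open>F' x\<inverse> \<circ> F' xs\<close> has norm at most \<open>1 / (1 - mass s)\<close>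
  (\<open>invertible_perturbation\<close>).  Integrating the hypothesis along the segment from \<open>xs\<close> to \<open>x\<close> bounds
  the error of linearizing \<open>F\<close> at \<open>x\<close>, measured after applying \<open>F' xs\<inverse>\<close>, by \<open>moment s\<close>
  (\<open>newton_residual\<close>).  The product of the two bounds is \<open>step s\<close>, and \<open>step\<close> is the map that
  generates the scalar sequence.  As \<open>step\<close> is increasing, the scalar sequence dominates
  the errors of the Newton sequence (\<open>newton_seq_majorized\<close>).

  Below \<open>\<rho>\<close> the map satisfies \<open>step t < t\<close>, so its orbits decrease to its only fixed point \<open>0\<close>.
  Since \<open>moment t \<le> t * mass t\<close>, the contraction factor is at most \<open>mass t / (1 - mass t)\<close>, which
  vanishes with \<open>t\<close>; this makes both sequences superlinear.

  Linearizing at \<open>xs\<close> instead gives, in the same sense, an error of at most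
  \<open>area s = s * mass s - moment s\<close>, so a zero at distance \<open>s > 0\<close> would force \<open>s \<le> area s\<close>, which
  fails below \<open>\<sigma>\<close> (\<open>unique_zero\<close>).

  The radius is sharp because the scalar model is itself an instance of the setting: Newton's method for
  the odd function that equals \<open>area t - t\<close> for \<open>t \<ge> 0\<close> is \<open>t \<mapsto> - step t\<close> there, and a fixed point
  of \<open>step\<close> starts a cycle of length two (\<open>two_cycle_at_fixed_point\<close>).

  Finally, if \<open>t powr (1 - p) * L t\<close> is nondecreasing, then rescaling the integral shows that
  \<open>moment t / t powr (p + 1)\<close> is nondecreasing; hence \<open>step t / t powr (p + 1)\<close> is strictly increasing
  (\<open>step_ratio_strict_mono\<close>), from which both statements on the order of convergence follow.
\<close>

section \<open>The scalar majorant\<close>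

locale majorant =
  fixes L :: "real \<Rightarrow> real" and R :: real
  assumes R_pos: "0 < R"
    and L_pos: "\<And>u. u \<in> {0..<R} \<Longrightarrow> 0 < L u"
    and L_integrable: "L absolutely_integrable_on {0..<R}"
begin

definition mass :: "real \<Rightarrow> real"
  where "mass t = integral {0..t} L"

definition moment :: "real \<Rightarrow> real"
  where "moment t = integral {0..t} (\<lambda>u. L u * u)"

text \<open>
  The integral of \<open>mass\<close> over \<open>[0, t]\<close>, written as a single integral; see \<open>has_real_derivative_area\<close>.
\<close>

definition area :: "real \<Rightarrow> real"
  where "area t = integral {0..t} (\<lambda>u. L u * (t - u))"

text \<open>
  Newton's method for the scalar equation \<open>area t = t\<close> sends \<open>t\<close> to \<open>- step t\<close>.
\<close>

definition step :: "real \<Rightarrow> real"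
  where "step t = moment t / (1 - mass t)"

lemma L_abs_integrable_subinterval:
  assumes "0 \<le> a" "b < R"
  shows "L absolutely_integrable_on {a..b}"
  by (rule absolutely_integrable_on_subinterval[OF L_integrable]) (use assms in auto)

lemma L_integrable_subinterval:
  assumes "0 \<le> a" "b < R"
  shows "L integrable_on {a..b}"
  using L_abs_integrable_subinterval[OF assms] set_lebesgue_integral_eq_integral(1) by blast

lemma moment_integrable_subinterval:
  assumes "0 \<le> a" "b < R"
  shows "(\<lambda>u. L u * u) integrable_on {a..b}"
proof -
  have "(\<lambda>u. u * L u) absolutely_integrable_on {a..b}"
    by (rule absolutely_integrable_bounded_measurable_product_real)
      (use L_abs_integrable_subinterval[OF assms] in
        \<open>auto intro!: continuous_imp_measurable_on_sets_lebesgue continuous_intros\<close>)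
  then show ?thesis
    using set_lebesgue_integral_eq_integral(1) by (auto simp: mult.commute)
qed

lemma mass_diff:
  assumes "0 \<le> x" "x \<le> y" "y < R"
  shows "integral {x..y} L = mass y - mass x"
  using Henstock_Kurzweil_Integration.integral_combine[of 0 x y L]
    L_integrable_subinterval[of 0 y] assms
  by (simp add: mass_def)

lemma moment_diff:
  assumes "0 \<le> x" "x \<le> y" "y < R"
  shows "integral {x..y} (\<lambda>u. L u * u) = moment y - moment x"
  using Henstock_Kurzweil_Integration.integral_combine[of 0 x y "\<lambda>u. L u * u"]
    moment_integrable_subinterval[of 0 y] assms
  by (simp add: moment_def)

lemma mass_0 [simp]: "mass 0 = 0" and moment_0 [simp]: "moment 0 = 0"
  by (simp_all add: mass_def moment_def)

lemma area_eq:
  assumes "0 \<le> t" "t < R"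
  shows "area t = t * mass t - moment t"
proof -
  have "((\<lambda>u. t * L u - L u * u) has_integral t * mass t - moment t) {0..t}"
    unfolding mass_def moment_def
    using L_integrable_subinterval[of 0 t] moment_integrable_subinterval[of 0 t] assms
    by (intro has_integral_diff has_integral_mult_right integrable_integral) auto
  then show ?thesis
    unfolding area_def by (intro integral_unique) (simp add: algebra_simps)
qed

text \<open>
  \<open>L\<close> is merely integrable, so strictness comes from measure theory: a positive function whose
  integral over \<open>[x, y]\<close> vanishes would make that interval a null set.
\<close>

lemma mass_strict_mono:
  assumes "0 \<le> x" "x < y" "y < R"
  shows "mass x < mass y"
proof -
  have nonneg: "0 \<le> indicat_real {x..y} u * L u" for u
    using L_pos[of u] assms by (auto simp: indicator_def)
  have int: "set_integrable lebesgue {x..y} L"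
    using L_abs_integrable_subinterval assms by simp
  have eq: "(LINT u:{x..y}|lebesgue. L u) = mass y - mass x"
    using set_lebesgue_integral_eq_integral(2)[OF int] mass_diff assms by simp
  have "0 \<le> (LINT u:{x..y}|lebesgue. L u)"
    unfolding set_lebesgue_integral_def using nonneg by (intro integral_nonneg_AE) auto
  moreover have "(LINT u:{x..y}|lebesgue. L u) \<noteq> 0"
  proof
    assume "(LINT u:{x..y}|lebesgue. L u) = 0"
    then have "AE u in lebesgue. indicat_real {x..y} u * L u = 0"
      using int nonneg integral_nonneg_eq_0_iff_AE[of lebesgue "\<lambda>u. indicat_real {x..y} u * L u"]
      by (auto simp: set_lebesgue_integral_def set_integrable_def)
    then have "AE u in lebesgue. u \<notin> {x..y}"
    proof eventually_elim
      case (elim u)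
      show ?case using elim L_pos[of u] assms by (auto simp: indicator_def)
    qed
    then have "negligible {x..y}"
      by (simp add: AE_iff_null_sets negligible_iff_null_sets)
    then show False
      using assms negligible_interval(1)[of x y] by auto
  qed
  ultimately show ?thesis using eq by simp
qed

lemma mass_mono:
  assumes "0 \<le> x" "x \<le> y" "y < R"
  shows "mass x \<le> mass y"
  using mass_strict_mono[of x y] assms by (cases "x = y") auto

text \<open>
  On \<open>[x, y]\<close> the weight \<open>u\<close> in the moment lies between \<open>x\<close> and \<open>y\<close>.  All further regularity of
  \<open>moment\<close> and \<open>area\<close> is obtained from this comparison with \<open>mass\<close>.
\<close>

lemma moment_increment:
  assumes "0 \<le> x" "x \<le> y" "y < R"
  shows "x * (mass y - mass x) \<le> moment y - moment x"
    and "moment y - moment x \<le> y * (mass y - mass x)"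
proof -
  have c: "((\<lambda>u. c * L u) has_integral c * (mass y - mass x)) {x..y}" for c
    using mass_diff[OF assms] L_integrable_subinterval[of x y] assms
    by (intro has_integral_mult_right) (metis integrable_integral)
  have m: "((\<lambda>u. L u * u) has_integral moment y - moment x) {x..y}"
    using moment_diff[OF assms] moment_integrable_subinterval[of x y] assms
    by (metis integrable_integral)
  have pos: "0 \<le> L u" if "u \<in> {x..y}" for u
    using L_pos[of u] that assms by auto
  show "x * (mass y - mass x) \<le> moment y - moment x"
    by (rule has_integral_le[OF c m]) (use pos in \<open>auto simp: mult.commute[of x] intro!: mult_left_mono\<close>)
  show "moment y - moment x \<le> y * (mass y - mass x)"
    by (rule has_integral_le[OF m c]) (use pos in \<open>auto simp: mult.commute[of y] intro!: mult_left_mono\<close>)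
qed

lemma moment_strict_mono:
  assumes "0 \<le> x" "x < y" "y < R"
  shows "moment x < moment y"
proof -
  \<comment> \<open>The midpoint is needed for \<open>x = 0\<close>, where the lower bound \<open>x * (mass y - mass x)\<close> degenerates.\<close>
  define z where "z = (x + y) / 2"
  have z: "0 < z" "x < z" "z < y" using assms by (auto simp: z_def)
  have "0 < z * (mass y - mass z)"
    using z assms mass_strict_mono[of z y] by simp
  also have "\<dots> \<le> moment y - moment z"
    using z assms by (intro moment_increment) auto
  finally have "moment z < moment y" by simp
  moreover have "0 \<le> x * (mass z - mass x)"
    using z assms mass_mono[of x z] by simp
  then have "moment x \<le> moment z"
    using moment_increment(1)[of x z] z assms by linarith
  ultimately show ?thesis by simp
qed

lemma moment_pos: "0 < t \<Longrightarrow> t < R \<Longrightarrow> 0 < moment t"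
  using moment_strict_mono[of 0 t] by simp

lemma moment_nonneg: "0 \<le> t \<Longrightarrow> t < R \<Longrightarrow> 0 \<le> moment t"
  using moment_pos[of t] by (cases "t = 0") auto

lemma moment_le: "0 \<le> t \<Longrightarrow> t < R \<Longrightarrow> moment t \<le> t * mass t"
  using moment_increment(2)[of 0 t] by simp

text \<open>
  The indefinite integral is continuous on each \<open>[0, b]\<close> with \<open>b < R\<close>, and continuity is local.
\<close>

lemma continuous_on_mass: "continuous_on {0..<R} mass"
  unfolding continuous_on_eq_continuous_within
proof
  fix t assume t: "t \<in> {0..<R}"
  define b where "b = (t + R) / 2"
  have b: "t < b" "b < R" using t by (auto simp: b_def)
  have "continuous_on {0..b} mass"
    unfolding mass_def [abs_def]
    using L_integrable_subinterval[of 0 b] b by (intro indefinite_integral_continuous_1) auto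
  then have "continuous (at t within {0..b}) mass"
    using t b by (auto simp: continuous_on_eq_continuous_within)
  moreover have "at t within {0..b} = at t within {0..<R}"
    by (rule at_within_nhd[of _ "{..<b}"]) (use t b in auto)
  ultimately show "continuous (at t within {0..<R}) mass"
    by (simp add: continuous_within)
qed

lemma isCont_mass: "0 < t \<Longrightarrow> t < R \<Longrightarrow> isCont mass t"
  using continuous_on_interior[OF continuous_on_mass, of t]
  by (simp add: interior_atLeastLessThan)

text \<open>
  This is integration by parts for \<open>t * mass t - moment t\<close>.  As \<open>L\<close> need not be continuous, \<open>mass\<close> need
  not be differentiable, and the difference quotient is estimated directly: by \<open>moment_increment\<close>, the
  remainder over \<open>[t, y]\<close> is at most \<open>(y - t) * (mass y - mass t)\<close>.
\<close>

lemma has_real_derivative_area: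
  assumes t: "0 < t" "t < R"
  shows "(area has_real_derivative mass t) (at t)"
proof -
  have key: "\<bar>area y - area t - mass t * (y - t)\<bar> \<le> \<bar>mass y - mass t\<bar> * \<bar>y - t\<bar>"
    if y: "y \<in> {0<..<R}" for y
  proof -
    have eq: "area y - area t - mass t * (y - t) = y * (mass y - mass t) - (moment y - moment t)"
      using y t by (simp add: area_eq algebra_simps)
    show ?thesis
    proof (cases "t \<le> y")
      case True
      then show ?thesis unfolding eq
        using moment_increment[of t y] mass_mono[of t y] y t by (simp add: algebra_simps)
    next
      case False
      then show ?thesis unfolding eq
        using moment_increment[of y t] mass_mono[of y t] y t by (simp add: algebra_simps)
    qed
  qed
  have "((\<lambda>y. (area y - area t) / (y - t) - mass t) \<longlongrightarrow> 0) (at t)"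
  proof (rule Lim_null_comparison)
    have "\<forall>\<^sub>F y in at t. y \<in> {0<..<R} \<and> y \<noteq> t"
      using t eventually_at_in_open'[of "{0<..<R}" t]
      by (auto simp: eventually_conj_iff eventually_at_filter)
    then show "\<forall>\<^sub>F y in at t. norm ((area y - area t) / (y - t) - mass t) \<le> \<bar>mass y - mass t\<bar>"
    proof eventually_elim
      case (elim y)
      have "(area y - area t) / (y - t) - mass t = (area y - area t - mass t * (y - t)) / (y - t)"
        using elim by (simp add: field_simps)
      then show ?case
        using key[of y] elim by (simp add: abs_divide divide_le_eq)
    qed
    show "((\<lambda>y. \<bar>mass y - mass t\<bar>) \<longlongrightarrow> 0) (at t)"
      using isCont_mass[OF t] by (auto simp: isCont_def intro!: tendsto_rabs_zero LIM_zero)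
  qed
  then show ?thesis
    by (simp add: has_field_derivative_iff LIM_zero_cancel)
qed

lemma area_0 [simp]: "area 0 = 0"
  by (simp add: area_def)

lemma area_bounds:
  assumes "0 \<le> t" "t < R"
  shows "0 \<le> area t" "area t \<le> t * mass t"
  using assms moment_le[of t] moment_nonneg[of t] by (auto simp: area_eq)

lemma continuous_on_moment: "continuous_on {0..<R} moment"
  unfolding continuous_on_eq_continuous_within continuous_within
proof
  fix t assume t: "t \<in> {0..<R}"
  have "((\<lambda>y. moment y - moment t) \<longlongrightarrow> 0) (at t within {0..<R})"
  proof (rule Lim_null_comparison)
    have "\<forall>\<^sub>F y in at t within {0..<R}. y \<in> {0..<R}"
      by (simp add: eventually_at_filter)
    then show "\<forall>\<^sub>F y in at t within {0..<R}. norm (moment y - moment t) \<le> R * \<bar>mass y - mass t\<bar>"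
    proof eventually_elim
      case (elim y)
      have *: "\<bar>moment b - moment a\<bar> \<le> R * \<bar>mass b - mass a\<bar>" if "0 \<le> a" "a \<le> b" "b < R" for a b
      proof -
        have d: "0 \<le> mass b - mass a" using mass_mono that by simp
        then have "0 \<le> a * (mass b - mass a)" "b * (mass b - mass a) \<le> R * (mass b - mass a)"
          using that by (auto intro: mult_right_mono)
        then show ?thesis using moment_increment[OF that] d by simp
      qed
      show ?case using *[of t y] *[of y t] elim t
        by (cases "t \<le> y") (auto simp: abs_minus_commute)
    qed
    have "((\<lambda>y. mass y - mass t) \<longlongrightarrow> 0) (at t within {0..<R})"
      using continuous_on_mass t
      by (auto simp: continuous_on_def intro: LIM_zero)
    then show "((\<lambda>y. R * \<bar>mass y - mass t\<bar>) \<longlongrightarrow> 0) (at t within {0..<R})"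
      by (auto intro!: tendsto_mult_right_zero tendsto_rabs_zero)
  qed
  then show "(moment \<longlongrightarrow> moment t) (at t within {0..<R})"
    by (rule LIM_zero_cancel)
qed

lemma continuous_on_area: "continuous_on {0..<R} area"
proof -
  have "continuous_on {0..<R} (\<lambda>t. t * mass t - moment t)"
    by (intro continuous_intros continuous_on_mass continuous_on_moment)
  then show ?thesis
    by (rule continuous_on_eq) (simp add: area_eq)
qed

lemma mass_less_near_0:
  assumes "0 < e"
  obtains d where "0 < d" "d < R" "\<And>t. t \<in> {0..d} \<Longrightarrow> mass t < e"
proof -
  have "0 \<in> {0..<R}" using R_pos by simp
  with continuous_on_mass assms obtain d where d: "0 < d"
    "\<And>t. t \<in> {0..<R} \<Longrightarrow> dist t 0 < d \<Longrightarrow> dist (mass t) (mass 0) < e"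
    unfolding continuous_on_iff by meson
  show thesis
  proof (rule that[of "min d R / 2"])
    show "0 < min d R / 2" "min d R / 2 < R" using d R_pos by auto
    show "mass t < e" if "t \<in> {0..min d R / 2}" for t
      using d(2)[of t] that d(1) R_pos by (auto simp: dist_real_def)
  qed
qed

text \<open>
  The factor \<open>mass t / (1 - mass t)\<close> tends to \<open>0\<close> with \<open>t\<close>; it carries the superlinear convergence of
  both sequences.
\<close>

lemma step_le:
  assumes "0 \<le> t" "t < R" "mass t < 1"
  shows "step t \<le> mass t / (1 - mass t) * t"
  using moment_le[of t] assms by (simp add: step_def divide_right_mono mult.commute)

lemma step_pos: "0 < t \<Longrightarrow> t < R \<Longrightarrow> mass t < 1 \<Longrightarrow> 0 < step t"
  using moment_pos[of t] by (simp add: step_def)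

lemma step_mono:
  assumes "0 \<le> s" "s \<le> t" "t < R" "mass t < 1"
  shows "step s \<le> step t"
  unfolding step_def
  using assms mass_mono[of s t] moment_nonneg[of t] moment_strict_mono[of s t]
  by (intro frac_le) (auto simp: le_less)

lemma scalar_seq_Suc: "scalar_seq L t (Suc k) = step (scalar_seq L t k)"
  by (simp add: step_def mass_def moment_def)

text \<open>
  Every radius up to \<open>\<rho>\<close> has this property, and all that the iteration uses about \<open>\<rho>\<close> is contained in it.
\<close>

definition contractive_below :: "real \<Rightarrow> bool"
  where "contractive_below \<rho> \<longleftrightarrow> \<rho> \<le> R \<and> (\<forall>t\<in>{0<..<\<rho>}. mass t < 1 \<and> step t < t)"

text \<open>
  Since \<open>mass\<close> is monotone, the set whose supremum is \<open>\<nu>\<close> is an interval starting at \<open>0\<close>.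
\<close>

lemma nu_properties:
  assumes "\<nu> = Sup {t \<in> {0..<R}. mass t - 1 < 0}"
  shows "0 < \<nu>" "\<nu> \<le> R" "\<And>t. 0 \<le> t \<Longrightarrow> t < \<nu> \<Longrightarrow> mass t < 1"
proof -
  let ?S = "{t \<in> {0..<R}. mass t - 1 < 0}"
  obtain d where d: "0 < d" "d < R" "\<And>t. t \<in> {0..d} \<Longrightarrow> mass t < 1"
    using mass_less_near_0[of 1] by auto
  have bdd: "bdd_above ?S" by (rule bdd_aboveI[of _ R]) auto
  have "d \<in> ?S" using d by auto
  then show "0 < \<nu>" "\<nu> \<le> R"
    using bdd d assms by (auto intro!: cSup_least less_le_trans[OF _ cSup_upper])
  fix t assume t: "0 \<le> t" "t < \<nu>"
  then obtain s where "s \<in> ?S" "t < s"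
    using less_cSup_iff[of ?S t] bdd \<open>d \<in> ?S\<close> assms by auto
  then show "mass t < 1" using mass_mono[of t s] t by auto
qed

text \<open>
  The quotient defining \<open>\<rho>\<close> is \<open>step t / t\<close>.  Where \<open>mass t < 1/2\<close>, the factor in \<open>step_le\<close> is below \<open>1\<close>,
  so the supremum is taken over a nonempty set.
\<close>

lemma rho_properties:
  assumes "\<nu> = Sup {t \<in> {0..<R}. mass t - 1 < 0}"
    and rho: "\<rho> = Sup {\<delta> \<in> {0<..<\<nu>}. \<forall>t\<in>{0<..<\<delta>}. moment t / (t * (1 - mass t)) < 1}"
  shows "0 < \<rho>" "\<rho> \<le> \<nu>" "contractive_below \<rho>"
proof -
  note nu = nu_properties[OF assms(1)]
  let ?S = "{\<delta> \<in> {0<..<\<nu>}. \<forall>t\<in>{0<..<\<delta>}. moment t / (t * (1 - mass t)) < 1}"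
  have ratio: "moment t / (t * (1 - mass t)) = step t / t" for t
    by (simp add: step_def)
  obtain d where d: "0 < d" "d < R" "\<And>t. t \<in> {0..d} \<Longrightarrow> mass t < 1/2"
    using mass_less_near_0[of "1/2"] by auto
  define e where "e = min d (\<nu> / 2)"
  have e: "0 < e" "e < \<nu>" "e \<le> d" using d nu by (auto simp: e_def)
  have "step t / t < 1" if "t \<in> {0<..<e}" for t
  proof -
    have t: "0 < t" "t < R" "mass t < 1/2" using that e d by auto
    have "step t \<le> mass t / (1 - mass t) * t" using t by (intro step_le) auto
    also have "\<dots> < 1 * t" using t by (intro mult_strict_right_mono) (auto simp: divide_less_eq)
    finally show ?thesis using t by simp
  qed
  then have "e \<in> ?S" using e by (auto simp: ratio)
  have bdd: "bdd_above ?S" by (rule bdd_aboveI[of _ \<nu>]) auto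
  show "0 < \<rho>" "\<rho> \<le> \<nu>"
    using bdd \<open>e \<in> ?S\<close> e rho by (auto intro!: cSup_least less_le_trans[OF _ cSup_upper])
  have "mass t < 1 \<and> step t < t" if "t \<in> {0<..<\<rho>}" for t
  proof -
    have "t < Sup ?S" using that rho by simp
    then obtain s where "s \<in> ?S" "t < s"
      using less_cSup_iff[of ?S t] bdd \<open>e \<in> ?S\<close> by blast
    then have "step t / t < 1" using that by (auto simp: ratio)
    then show ?thesis using that nu(3)[of t] \<open>\<rho> \<le> \<nu>\<close> by (auto simp: divide_less_eq)
  qed
  then show "contractive_below \<rho>"
    using \<open>\<rho> \<le> \<nu>\<close> nu by (auto simp: contractive_below_def)
qed

text \<open>
  The function \<open>area\<close> is convex and vanishes at \<open>0\<close>, so \<open>area t / t\<close> is nondecreasing, and \<open>area s < s\<close> at a single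
  point \<open>s\<close> gives the inequality at all smaller ones.
\<close>

lemma area_less_below_sigma:
  assumes "\<kappa> \<le> R" "0 < \<kappa>" and sigma: "\<sigma> = Sup {t \<in> {0<..<\<kappa>}. area t - t < 0}"
  shows "0 < \<sigma>" "\<sigma> \<le> \<kappa>" "\<And>t. 0 < t \<Longrightarrow> t < \<sigma> \<Longrightarrow> area t < t"
proof -
  let ?S = "{t \<in> {0<..<\<kappa>}. area t - t < 0}"
  obtain d where d: "0 < d" "d < R" "\<And>t. t \<in> {0..d} \<Longrightarrow> mass t < 1"
    using mass_less_near_0[of 1] by auto
  define e where "e = min d (\<kappa> / 2)"
  have e: "0 < e" "e < \<kappa>" "e \<le> d" using d assms by (auto simp: e_def)
  have "area e \<le> e * mass e" using area_bounds[of e] e d by auto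
  also have "\<dots> < e * 1" using e d(3)[of e] by (intro mult_strict_left_mono) auto
  finally have "e \<in> ?S" using e by auto
  have bdd: "bdd_above ?S" by (rule bdd_aboveI[of _ \<kappa>]) auto
  show "0 < \<sigma>" "\<sigma> \<le> \<kappa>"
    using bdd \<open>e \<in> ?S\<close> e sigma by (auto intro!: cSup_least less_le_trans[OF _ cSup_upper])
  fix t assume t: "0 < t" "t < \<sigma>"
  then obtain s where s: "s \<in> ?S" "t < s"
    using less_cSup_iff[of ?S t] bdd \<open>e \<in> ?S\<close> sigma by auto
  have "s * area t \<le> t * area s"
  proof -
    \<comment> \<open>The right-hand side is \<open>t * area s - s * area t\<close>.\<close>
    have "0 \<le> t * (s * (mass s - mass t) - (moment s - moment t)) + (s - t) * moment t"
      using moment_increment(2)[of t s] moment_nonneg[of t] s t assms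
      by (intro add_nonneg_nonneg mult_nonneg_nonneg) auto
    then show ?thesis using s t assms by (simp add: area_eq algebra_simps)
  qed
  also have "\<dots> < t * s" using s t by auto
  finally show "area t < t" using s t by (simp add: mult.commute)
qed

end

section \<open>Iterating the scalar majorant\<close>

context majorant
begin

lemma contraction_factor_tendsto_0:
  assumes "s \<longlonglongrightarrow> 0" "\<And>k. s k \<in> {0..<R}"
  shows "(\<lambda>k. mass (s k) / (1 - mass (s k))) \<longlonglongrightarrow> 0"
proof -
  have "(\<lambda>k. mass (s k)) \<longlonglongrightarrow> mass 0"
    by (rule continuous_on_tendsto_compose[OF continuous_on_mass assms(1)]) (use assms R_pos in auto)
  then have m: "(\<lambda>k. mass (s k)) \<longlonglongrightarrow> 0" by simp
  have "(\<lambda>k. mass (s k) / (1 - mass (s k))) \<longlonglongrightarrow> 0 / (1 - 0)"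
    by (intro tendsto_intros m) simp
  then show ?thesis by simp
qed

lemma contractive_below_mono: "contractive_below \<rho> \<Longrightarrow> r \<le> \<rho> \<Longrightarrow> contractive_below r"
  by (auto simp: contractive_below_def)

lemma scalar_seq_range:
  assumes "contractive_below r" "t0 \<in> {0<..<r}"
  shows "scalar_seq L t0 k \<in> {0<..<r}"
proof (induction k)
  case (Suc k)
  let ?t = "scalar_seq L t0 k"
  have "0 < step ?t" "step ?t < ?t"
    using Suc assms step_pos[of ?t] by (auto simp: contractive_below_def)
  then show ?case using Suc by (auto simp only: scalar_seq_Suc greaterThanLessThan_iff)
qed (use assms in simp)

lemma scalar_seq_decreasing:
  assumes "contractive_below r" "t0 \<in> {0<..<r}"
  shows "scalar_seq L t0 (Suc k) < scalar_seq L t0 k"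
  using scalar_seq_range[OF assms, of k] assms by (simp only: scalar_seq_Suc contractive_below_def)

lemma scalar_seq_well_defined:
  assumes "contractive_below r" "t0 \<in> {0<..<r}"
  shows "scalar_well_defined R L t0"
  unfolding scalar_well_defined_def mass_def[symmetric]
proof
  fix k
  show "scalar_seq L t0 k \<in> {0..<R} \<and> 1 - mass (scalar_seq L t0 k) \<noteq> 0"
    using scalar_seq_range[OF assms, of k] assms(1) unfolding contractive_below_def by fastforce
qed

text \<open>
  The sequence decreases, and by continuity its limit is a fixed point of \<open>step\<close>; the only one below
  \<open>r\<close> is \<open>0\<close>.
\<close>

lemma scalar_seq_tendsto_0:
  assumes r: "contractive_below r" and t0: "t0 \<in> {0<..<r}"
  shows "scalar_seq L t0 \<longlonglongrightarrow> 0"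
proof -
  let ?t = "scalar_seq L t0"
  note range = scalar_seq_range[OF assms]
  have "decseq ?t"
    using scalar_seq_decreasing[OF assms] by (intro decseq_SucI less_imp_le)
  moreover have "\<forall>k. 0 \<le> ?t k" using range by (simp add: less_imp_le)
  ultimately obtain l where l: "?t \<longlonglongrightarrow> l" "\<forall>k. l \<le> ?t k"
    using decseq_convergent by blast
  have l_bounds: "0 \<le> l" "l < r"
    using LIMSEQ_le_const[OF l(1), of 0] range l(2)[rule_format, of 0] t0 by (auto simp: less_imp_le)
  have lR: "l \<in> {0..<R}" using l_bounds r by (auto simp: contractive_below_def)
  have tR: "?t k \<in> {0..<R}" for k using range[of k] r by (auto simp: contractive_below_def)
  have ml: "mass l < 1"
    using l_bounds r by (cases "l = 0") (auto simp: contractive_below_def)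
  have "(\<lambda>k. mass (?t k)) \<longlonglongrightarrow> mass l" "(\<lambda>k. moment (?t k)) \<longlonglongrightarrow> moment l"
    by (rule continuous_on_tendsto_compose[OF _ l(1) lR];
      use tR continuous_on_mass continuous_on_moment in simp)+
  then have "(\<lambda>k. step (?t k)) \<longlonglongrightarrow> step l"
    unfolding step_def using ml by (intro tendsto_intros) auto
  then have "(\<lambda>k. ?t (Suc k)) \<longlonglongrightarrow> step l"
    by (simp only: scalar_seq_Suc)
  then have "step l = l"
    using LIMSEQ_Suc[OF l(1)] LIMSEQ_unique by blast
  have "l = 0"
  proof (rule ccontr)
    assume "l \<noteq> 0"
    then have "l \<in> {0<..<r}" using l_bounds by simp
    then have "step l < l" using r unfolding contractive_below_def by blast
    with \<open>step l = l\<close> show False by simp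
  qed
  with l show ?thesis by simp
qed

lemma scalar_seq_superlinear:
  assumes r: "contractive_below r" and t0: "t0 \<in> {0<..<r}"
  shows "(\<lambda>k. scalar_seq L t0 (Suc k) / scalar_seq L t0 k) \<longlonglongrightarrow> 0"
proof -
  let ?t = "scalar_seq L t0"
  have t: "0 < ?t k" "?t k < R" "mass (?t k) < 1" "0 < ?t (Suc k)" for k
    using scalar_seq_range[OF assms, of k] scalar_seq_range[OF assms, of "Suc k"] r
    by (auto simp: contractive_below_def simp del: scalar_seq.simps)
  show ?thesis
  proof (rule tendsto_sandwich[OF _ _ tendsto_const])
    show "\<forall>\<^sub>F k in sequentially. 0 \<le> ?t (Suc k) / ?t k"
      using t by (simp add: less_imp_le del: scalar_seq.simps)
    show "\<forall>\<^sub>F k in sequentially. ?t (Suc k) / ?t k \<le> mass (?t k) / (1 - mass (?t k))"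
      using step_le t by (simp add: scalar_seq_Suc less_imp_le pos_divide_le_eq del: scalar_seq.simps)
    show "(\<lambda>k. mass (?t k) / (1 - mass (?t k))) \<longlonglongrightarrow> 0"
      using t by (intro contraction_factor_tendsto_0 scalar_seq_tendsto_0[OF assms]) (auto simp: less_imp_le)
  qed
qed

text \<open>
  Substituting \<open>u = c * v\<close> with \<open>c = a / b\<close> turns the integral over \<open>[0, a]\<close> into one over \<open>[0, b]\<close>.  There the
  integrand is \<open>(c * v) powr p\<close> times the monotone function at \<open>c * v\<close>, which is at most its value at \<open>v\<close>.
\<close>

lemma moment_scaling:
  assumes mono: "mono_on {0<..<\<nu>} (\<lambda>t. t powr (1 - p) * L t)"
    and "\<nu> \<le> R" "0 < a" "a \<le> b" "b < \<nu>"
  shows "moment a \<le> (a / b) powr (p + 1) * moment b"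
proof -
  define c where "c = a / b"
  have c: "0 < c" "c \<le> 1" "a = c * b" using assms by (auto simp: c_def)
  have M: "((\<lambda>u. L u * u) has_integral moment t) {0..t}" if "0 \<le> t" "t < R" for t
    using moment_integrable_subinterval[of 0 t] that
    by (auto simp: moment_def intro: integrable_integral)
  have "((\<lambda>v. L (c * v) * (c * v)) has_integral (1 / \<bar>c\<bar>) *\<^sub>R moment a) ((\<lambda>x. x / c) ` {0..a})"
    using has_integral_stretch_real[OF M[of a], of c] assms c by auto
  moreover have "(\<lambda>x. x / c) ` {0..a} = {0..b}"
    using image_divide_atLeastAtMost[of c 0 a] c by simp
  ultimately have lhs: "((\<lambda>v. L (c * v) * (c * v)) has_integral moment a / c) {0..b}"
    using c by simp
  have rhs: "((\<lambda>v. c powr p * (L v * v)) has_integral c powr p * moment b) {0..b}"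
    using M[of b] assms by (intro has_integral_mult_right) auto
  have "moment a / c \<le> c powr p * moment b"
  proof (rule has_integral_le[OF lhs rhs])
    fix v assume v: "v \<in> {0..b}"
    show "L (c * v) * (c * v) \<le> c powr p * (L v * v)"
    proof (cases "v = 0")
      case False
      then have v0: "0 < v" "0 < c * v" "c * v \<le> v" using v c mult_right_mono[of c 1 v] by auto
      have split: "w = w powr p * w powr (1 - p)" if "0 < w" for w :: real
        using that by (simp add: powr_add[symmetric])
      have "(c * v) powr (1 - p) * L (c * v) \<le> v powr (1 - p) * L v"
        using v0 v assms by (intro mono_onD[OF mono]) auto
      then have "(c * v) powr p * ((c * v) powr (1 - p) * L (c * v)) \<le>
          (c * v) powr p * (v powr (1 - p) * L v)"
        by (intro mult_left_mono) auto
      also have "\<dots> = c powr p * (L v * v)"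
        using c v0 split[of v] by (simp add: powr_mult mult_ac)
      finally show ?thesis using split[OF v0(2)] by (simp add: mult_ac)
    qed simp
  qed
  then have "moment a \<le> c powr p * c * moment b"
    using c by (simp add: divide_le_eq mult_ac)
  also have "c powr p * c = c powr (p + 1)"
    using c by (simp add: powr_add)
  finally show ?thesis by (simp add: c_def)
qed

text \<open>
  The numerator \<open>moment t / t powr (p + 1)\<close> is only nondecreasing; strictness is due to the denominator
  \<open>1 - mass t\<close>, which decreases strictly.
\<close>

lemma step_ratio_strict_mono:
  assumes mono: "mono_on {0<..<\<nu>} (\<lambda>t. t powr (1 - p) * L t)"
    and "\<nu> \<le> R" "0 < a" "a < b" "b < \<nu>" "mass b < 1"
  shows "step a / a powr (p + 1) < step b / b powr (p + 1)"
proof -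
  have m: "mass a < mass b" using mass_strict_mono assms by simp
  have "step a / a powr (p + 1) = moment a / a powr (p + 1) / (1 - mass a)"
    by (simp add: step_def)
  also have "\<dots> \<le> (moment b / b powr (p + 1)) / (1 - mass a)"
    using moment_scaling[OF mono, of a b] assms m
    by (intro divide_right_mono) (auto simp: powr_divide field_simps)
  also have "\<dots> < (moment b / b powr (p + 1)) / (1 - mass b)"
    using moment_pos[of b] assms m by (intro divide_strict_left_mono mult_pos_pos divide_pos_pos) auto
  also have "\<dots> = step b / b powr (p + 1)"
    by (simp add: step_def)
  finally show ?thesis .
qed

end

section \<open>Inverses of perturbed operators and linearization errors\<close>

text \<open>
  The equation \<open>T z = y\<close> says that \<open>z\<close> is a fixed point of \<open>z \<mapsto> y + (z - T z)\<close>, a contraction with constant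
  \<open>q\<close>; Banach's theorem makes \<open>T\<close> bijective.  The lower bound on \<open>norm (T z)\<close> makes its inverse bounded.
\<close>

lemma invertible_near_identity:
  fixes T :: "'a::banach \<Rightarrow>\<^sub>L 'a"
  assumes "norm (T - id_blinfun) \<le> q" "q < 1"
  shows "blinfun_invertible T" and "(1 - q) * norm z \<le> norm (T z)"
proof -
  have q0: "0 \<le> q" using assms(1) norm_ge_zero order_trans by blast
  have dev: "norm (T z - z) \<le> q * norm z" for z
    using norm_blinfun[of "T - id_blinfun" z] assms(1)
    by (simp add: blinfun.diff_left) (meson mult_right_mono norm_ge_zero order_trans)
  have low: "(1 - q) * norm z \<le> norm (T z)" for z
    using dev[of z] norm_triangle_ineq2[of z "T z"] by (simp add: algebra_simps norm_minus_commute)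
  then show "(1 - q) * norm z \<le> norm (T z)" .
  have "\<exists>!z. T z = y" for y
  proof -
    have "\<exists>!z. y + (z - T z) = z"
    proof (rule banach_fix_type[OF q0 assms(2)], intro allI)
      fix u v
      show "dist (y + (u - T u)) (y + (v - T v)) \<le> q * dist u v"
        using dev[of "u - v"]
        by (simp add: dist_norm blinfun.diff_right algebra_simps norm_minus_commute)
    qed
    moreover have "y + (z - T z) = z \<longleftrightarrow> T z = y" for z
      by (auto simp: algebra_simps)
    ultimately show ?thesis by simp
  qed
  then obtain S where TS: "\<And>y. T (S y) = y" and ST: "\<And>z. S (T z) = z"
    by metis
  have S: "bounded_linear S"
  proof (rule bounded_linear_intro[of _ "1 / (1 - q)"])
    show "S (x + y) = S x + S y" for x y
      by (metis ST TS blinfun.add_right)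
    show "S (r *\<^sub>R x) = r *\<^sub>R S x" for r x
      by (metis ST TS blinfun.scaleR_right)
    show "norm (S x) \<le> norm x * (1 / (1 - q))" for x
      using low[of "S x"] assms(2) by (simp add: TS field_simps)
  qed
  have "T o\<^sub>L Blinfun S = id_blinfun" "Blinfun S o\<^sub>L T = id_blinfun"
    by (auto intro!: blinfun_eqI simp: bounded_linear_Blinfun_apply[OF S] TS ST)
  then show "blinfun_invertible T"
    unfolding blinfun_invertible_def by blast
qed

lemma blinfun_inverse_eqI:
  assumes "A o\<^sub>L B = id_blinfun" "B o\<^sub>L A = id_blinfun"
  shows "blinfun_inverse A = B"
  unfolding blinfun_inverse_def
proof (rule the_equality)
  fix C assume "A o\<^sub>L C = id_blinfun \<and> C o\<^sub>L A = id_blinfun"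
  then have "A (C y) = y" "C (A x) = x" for x y
    by (metis blinfun_apply_blinfun_compose blinfun_apply_id_blinfun)+
  moreover have "A (B y) = y" for y
    using assms by (metis blinfun_apply_blinfun_compose blinfun_apply_id_blinfun)
  ultimately show "C = B" by (metis blinfun_eqI)
qed (use assms in simp)

lemma blinfun_inverse_apply:
  assumes "blinfun_invertible A"
  shows "A (blinfun_inverse A y) = y" "blinfun_inverse A (A x) = x"
proof -
  obtain B where B: "A o\<^sub>L B = id_blinfun" "B o\<^sub>L A = id_blinfun"
    using assms by (auto simp: blinfun_invertible_def)
  show "A (blinfun_inverse A y) = y" "blinfun_inverse A (A x) = x"
    using B by (metis blinfun_inverse_eqI blinfun_apply_blinfun_compose blinfun_apply_id_blinfun)+
qed

text \<open>
  Factor \<open>B\<close> as \<open>A \<circ> T\<close> with \<open>T\<close> close to the identity.  The norm estimate is kept pointwise, in terms of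
  \<open>blinfun_inverse A y\<close>, because the hypothesis on \<open>F'\<close> controls only quantities premultiplied by that inverse.
\<close>

lemma invertible_perturbation:
  fixes A B :: "'a::banach \<Rightarrow>\<^sub>L 'b::banach"
  assumes A: "blinfun_invertible A"
    and near: "norm (blinfun_inverse A o\<^sub>L (B - A)) \<le> q" "q < 1"
  shows "blinfun_invertible B"
    and "norm (blinfun_inverse B y) \<le> norm (blinfun_inverse A y) / (1 - q)"
proof -
  define T where "T = blinfun_inverse A o\<^sub>L B"
  have "T - id_blinfun = blinfun_inverse A o\<^sub>L (B - A)"
    by (rule blinfun_eqI)
      (simp add: T_def blinfun.diff_left blinfun.diff_right blinfun_inverse_apply[OF A])
  with near have T: "norm (T - id_blinfun) \<le> q" by simp
  note inv = invertible_near_identity[OF T near(2)]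
  have AT: "A (T x) = B x" for x
    by (simp add: T_def blinfun_inverse_apply[OF A])
  let ?C = "blinfun_inverse T o\<^sub>L blinfun_inverse A"
  have "B o\<^sub>L ?C = id_blinfun"
    by (rule blinfun_eqI)
      (simp add: AT[symmetric] blinfun_inverse_apply[OF inv(1)] blinfun_inverse_apply[OF A])
  moreover have "?C o\<^sub>L B = id_blinfun"
    by (rule blinfun_eqI)
      (simp add: AT[symmetric] blinfun_inverse_apply[OF inv(1)] blinfun_inverse_apply[OF A])
  ultimately show B: "blinfun_invertible B"
    by (auto simp: blinfun_invertible_def)
  have "(1 - q) * norm (blinfun_inverse B y) \<le> norm (blinfun_inverse A y)"
    using inv(2)[of "blinfun_inverse B y"] by (simp add: T_def blinfun_inverse_apply[OF B])
  then show "norm (blinfun_inverse B y) \<le> norm (blinfun_inverse A y) / (1 - q)"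
    using near(2) by (simp add: field_simps)
qed

text \<open>
  The mean value inequality for the linearization error along the segment from \<open>a\<close> to \<open>a + h\<close>.  Bounding by
  the increment of a majorant \<open>\<phi>\<close>, rather than by an integral of its derivative, lets closed forms such as
  \<open>area\<close> enter directly and avoids iterated integrals.
\<close>

lemma linearization_error:
  fixes F :: "'a::real_normed_vector \<Rightarrow> 'b::real_normed_vector" and P :: "'b \<Rightarrow>\<^sub>L 'c::real_normed_vector"
  assumes F: "\<And>\<tau>. \<tau> \<in> {0..1} \<Longrightarrow> (F has_derivative F' (a + \<tau> *\<^sub>R h)) (at (a + \<tau> *\<^sub>R h))"
    and \<phi>_cont: "continuous_on {0..1} \<phi>"
    and \<phi>: "\<And>\<tau>. \<tau> \<in> {0<..<1} \<Longrightarrow> (\<phi> has_real_derivative \<phi>' \<tau>) (at \<tau>)"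
    and bound: "\<And>\<tau>. \<tau> \<in> {0<..<1} \<Longrightarrow> norm (P (F' (a + \<tau> *\<^sub>R h) h - M h)) \<le> \<phi>' \<tau>"
  shows "norm (P (F (a + h) - F a - M h)) \<le> \<phi> 1 - \<phi> 0"
proof -
  define G where "G \<tau> = P (F (a + \<tau> *\<^sub>R h) - \<tau> *\<^sub>R M h)" for \<tau>
  have G: "(G has_vector_derivative P (F' (a + \<tau> *\<^sub>R h) h - M h)) (at \<tau>)" if "\<tau> \<in> {0..1}" for \<tau>
  proof -
    have "((\<lambda>\<tau>. a + \<tau> *\<^sub>R h) has_derivative (\<lambda>d. d *\<^sub>R h)) (at \<tau>)"
      by (auto intro!: derivative_eq_intros)
    from has_derivative_compose[OF this F[OF that]]
    have "((\<lambda>\<tau>. F (a + \<tau> *\<^sub>R h)) has_derivative (\<lambda>d. F' (a + \<tau> *\<^sub>R h) (d *\<^sub>R h))) (at \<tau>)" .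
    moreover have "linear (F' (a + \<tau> *\<^sub>R h))"
      using F[OF that] has_derivative_linear by blast
    ultimately have "((\<lambda>\<tau>. F (a + \<tau> *\<^sub>R h)) has_vector_derivative F' (a + \<tau> *\<^sub>R h) h) (at \<tau>)"
      by (simp add: has_vector_derivative_def linear_cmul)
    then have "((\<lambda>\<tau>. F (a + \<tau> *\<^sub>R h) - \<tau> *\<^sub>R M h) has_vector_derivative
        F' (a + \<tau> *\<^sub>R h) h - M h) (at \<tau>)"
      by (auto intro!: derivative_eq_intros)
    then show ?thesis
      unfolding G_def by (rule bounded_linear.has_vector_derivative[OF blinfun.bounded_linear_right])
  qed
  have "norm (G 1 - G 0) \<le> \<phi> 1 - \<phi> 0"
  proof (rule differentiable_bound_general[where f' = "\<lambda>\<tau>. P (F' (a + \<tau> *\<^sub>R h) h - M h)" and \<phi>' = \<phi>'])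
    show "continuous_on {0..1} G"
      using G by (intro continuous_at_imp_continuous_on)
        (meson has_vector_derivative_continuous)
  qed (use G \<phi>_cont \<phi> bound in \<open>auto simp: has_real_derivative_iff_has_vector_derivative\<close>)
  then show ?thesis
    by (simp add: G_def blinfun.diff_right[symmetric] algebra_simps)
qed

section \<open>Sharpness of the radius\<close>

context majorant
begin

text \<open>
  The extremal function of the setting: the odd extension of \<open>area t - t\<close>, whose Newton step multiplies
  the sign by \<open>-1\<close> and maps the distance to \<open>0\<close> by \<open>step\<close> exactly.
\<close>

definition oscillator :: "real \<Rightarrow> real"
  where "oscillator x = sgn x * (area \<bar>x\<bar> - \<bar>x\<bar>)"

text \<open>
  At \<open>0\<close> the two branches meet smoothly because \<open>area t \<le> t * mass t\<close> gives \<open>area t = o(t)\<close>.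
\<close>

lemma has_real_derivative_oscillator:
  assumes "\<bar>x\<bar> < R"
  shows "(oscillator has_real_derivative mass \<bar>x\<bar> - 1) (at x)"
proof -
  consider "0 < x" | "x < 0" | "x = 0" by linarith
  then show ?thesis
  proof cases
    case 1
    have "((\<lambda>y. area y - y) has_real_derivative mass x - 1) (at x)"
      using 1 assms by (auto intro!: derivative_eq_intros has_real_derivative_area)
    then have "(oscillator has_real_derivative mass x - 1) (at x)"
      by (rule has_field_derivative_transform_within_open[of _ _ _ "{0<..}"])
        (use 1 in \<open>auto simp: oscillator_def\<close>)
    then show ?thesis using 1 by simp
  next
    case 2
    have "((\<lambda>y. area (- y)) has_real_derivative mass (- x) * (- 1)) (at x)"
      using 2 assms by (intro DERIV_chain2[where f = area] has_real_derivative_area)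
        (auto intro!: derivative_eq_intros)
    then have "((\<lambda>y. - (area (- y) + y)) has_real_derivative mass (- x) - 1) (at x)"
      by (auto intro!: derivative_eq_intros)
    then have "(oscillator has_real_derivative mass (- x) - 1) (at x)"
      by (rule has_field_derivative_transform_within_open[of _ _ _ "{..<0}"])
        (use 2 in \<open>auto simp: oscillator_def\<close>)
    then show ?thesis using 2 by simp
  next
    case 3
    have "((\<lambda>y. oscillator y / y + 1) \<longlongrightarrow> 0) (at 0)"
    proof (rule Lim_null_comparison)
      have "\<forall>\<^sub>F y in at 0. y \<in> {-R<..<R} \<and> y \<noteq> 0"
        using R_pos eventually_at_in_open'[of "{-R<..<R}" 0]
        by (auto simp: eventually_conj_iff eventually_at_filter)
      then show "\<forall>\<^sub>F y in at 0. norm (oscillator y / y + 1) \<le> mass \<bar>y\<bar>"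
      proof eventually_elim
        case (elim y)
        have "oscillator y / y + 1 = area \<bar>y\<bar> / \<bar>y\<bar>"
          using elim by (auto simp: oscillator_def sgn_if field_simps abs_if)
        then show ?case
          using area_bounds[of "\<bar>y\<bar>"] elim by (auto simp: divide_le_eq mult.commute)
      qed
      have "(mass \<longlongrightarrow> mass 0) (at 0 within {0..<R})"
        using continuous_on_mass[unfolded continuous_on_def, rule_format, of 0] R_pos by simp
      moreover have "filterlim (\<lambda>y::real. \<bar>y\<bar>) (at 0 within {0..<R}) (at 0)"
      proof -
        have "\<forall>\<^sub>F y in at (0::real). \<bar>y\<bar> \<in> {0..<R} \<and> \<bar>y\<bar> \<noteq> 0"
          unfolding eventually_at using R_pos by (intro exI[of _ R]) (simp add: dist_real_def)
        moreover have "((\<lambda>y::real. \<bar>y\<bar>) \<longlongrightarrow> 0) (at 0)"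
          by (intro tendsto_rabs_zero tendsto_ident_at)
        ultimately show ?thesis
          unfolding filterlim_at by blast
      qed
      ultimately show "((\<lambda>y. mass \<bar>y\<bar>) \<longlongrightarrow> 0) (at 0)"
        using filterlim_compose by fastforce
    qed
    then have "((\<lambda>y. oscillator y / y) \<longlongrightarrow> - 1) (at 0)"
      using LIM_zero_cancel[of "\<lambda>y. oscillator y / y" "- 1"] by simp
    then show ?thesis
      using 3 by (simp add: has_field_derivative_iff oscillator_def)
  qed
qed

lemma oscillator_minus: "oscillator (- x) = - oscillator x"
  by (simp add: oscillator_def sgn_minus)

text \<open>
  The derivative at \<open>0\<close> is \<open>-1\<close>, and the derivative at \<open>x\<close> depends only on \<open>mass \<bar>x\<bar>\<close>; hence the
  hypothesis on the derivative holds with equality.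
\<close>

lemma newton_setting_oscillator:
  assumes "0 < \<kappa>" "\<kappa> \<le> R"
  shows "newton_setting (ball 0 \<kappa>) oscillator (\<lambda>x. blinfun_mult_right (mass \<bar>x\<bar> - 1)) 0 R \<kappa> L"
proof -
  let ?F' = "\<lambda>x. blinfun_mult_right (mass \<bar>x\<bar> - 1) :: real \<Rightarrow>\<^sub>L real"
  have inv: "blinfun_mult_right (-1 :: real) o\<^sub>L blinfun_mult_right (-1 :: real) = id_blinfun"
    by (rule blinfun_eqI) simp
  have F'0: "?F' 0 = blinfun_mult_right (-1)" by simp
  have inverse: "blinfun_inverse (?F' 0) = blinfun_mult_right (-1)"
    unfolding F'0 by (rule blinfun_inverse_eqI[OF inv inv])
  have "continuous_on (ball 0 \<kappa>) (\<lambda>x. mass \<bar>x\<bar>)"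
    by (rule continuous_on_compose2[OF continuous_on_mass])
      (use assms in \<open>auto intro!: continuous_intros\<close>)
  then have cont: "continuous_on (ball 0 \<kappa>) ?F'"
    by (intro bounded_linear.continuous_on[OF bounded_linear_blinfun_mult_right] continuous_intros)
  have sup: "\<kappa> = Sup {t \<in> {0..<R}. ball (0::real) t \<subseteq> ball 0 \<kappa>}"
  proof -
    let ?S = "{t \<in> {0..<R}. ball (0::real) t \<subseteq> ball 0 \<kappa>}"
    have "Sup ?S = \<kappa>"
    proof (rule cSup_eq_non_empty)
      show "?S \<noteq> {}" using R_pos by (auto intro!: exI[of _ 0])
      show "t \<le> \<kappa>" if "t \<in> ?S" for t
        using that assms by (auto simp: ball_subset_ball_iff)
      show "\<kappa> \<le> y" if "\<And>t. t \<in> ?S \<Longrightarrow> t \<le> y" for y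
        using assms by (intro dense_le_bounded[of 0 \<kappa>] that) auto
    qed
    then show ?thesis by simp
  qed
  have lip: "norm (blinfun_inverse (?F' 0) o\<^sub>L (?F' x - ?F' (0 + \<tau> *\<^sub>R (x - 0))))
      \<le> integral {\<tau> * norm (x - 0)..norm (x - 0)} L" if "\<tau> \<in> {0..1}" "x \<in> ball 0 \<kappa>" for \<tau> x
  proof -
    have x: "0 \<le> \<tau> * \<bar>x\<bar>" "\<tau> * \<bar>x\<bar> \<le> \<bar>x\<bar>" "\<bar>x\<bar> < R"
      using that assms mult_right_mono[of \<tau> 1 "\<bar>x\<bar>"] by auto
    have "norm (blinfun_inverse (?F' 0) o\<^sub>L (?F' x - ?F' (\<tau> * x))) \<le> mass \<bar>x\<bar> - mass (\<tau> * \<bar>x\<bar>)"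
    proof (rule norm_blinfun_bound)
      show "0 \<le> mass \<bar>x\<bar> - mass (\<tau> * \<bar>x\<bar>)" using mass_mono x by simp
      then show "norm ((blinfun_inverse (?F' 0) o\<^sub>L (?F' x - ?F' (\<tau> * x))) z)
          \<le> (mass \<bar>x\<bar> - mass (\<tau> * \<bar>x\<bar>)) * norm z" for z
        using that by (simp only: inverse)
          (simp add: blinfun.diff_left abs_mult left_diff_distrib[symmetric])
    qed
    also have "\<dots> = integral {\<tau> * norm (x - 0)..norm (x - 0)} L"
      using mass_diff[OF x] by simp
    finally show ?thesis by simp
  qed
  have der: "(oscillator has_derivative ?F' x) (at x)" if "x \<in> ball 0 \<kappa>" for x
    using has_real_derivative_oscillator[of x] that assms
    by (simp add: has_field_derivative_def)
  show ?thesis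
    unfolding newton_setting_def
    using assms R_pos L_pos L_integrable inv F'0 cont sup lip der
    by (auto simp: blinfun_invertible_def oscillator_def)
qed

text \<open>
  If \<open>step \<rho> = \<rho>\<close>, Newton's method for \<open>oscillator\<close> maps \<open>\<rho>\<close> to \<open>- \<rho>\<close> and, by oddness, back again.  The
  starting point \<open>\<rho>\<close> itself therefore defeats every radius larger than \<open>\<rho>\<close>.
\<close>

lemma two_cycle_at_fixed_point:
  assumes "0 < \<rho>" "\<rho> < \<kappa>" "\<kappa> \<le> R" "step \<rho> = \<rho>"
  shows "no_larger_convergence_radius R \<kappa> L \<rho>"
proof -
  let ?F' = "\<lambda>x. blinfun_mult_right (mass \<bar>x\<bar> - 1) :: real \<Rightarrow>\<^sub>L real"
  let ?x = "newton_seq oscillator ?F' \<rho>"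
  have m: "mass \<rho> \<noteq> 1"
    using assms by (auto simp: step_def)
  let ?c = "mass \<rho> - 1"
  have inverse: "blinfun_inverse (blinfun_mult_right ?c) = blinfun_mult_right (1 / ?c)"
    by (rule blinfun_inverse_eqI) (use m in \<open>auto intro!: blinfun_eqI simp: field_simps\<close>)
  have "moment \<rho> = \<rho> * (1 - mass \<rho>)"
    using assms m by (simp add: step_def field_simps)
  \<comment> \<open>As \<open>?c\<close> is the derivative at \<open>\<rho>\<close>, the Newton correction at \<open>\<rho>\<close> is \<open>2 * \<rho>\<close>.\<close>
  then have osc: "oscillator \<rho> = 2 * \<rho> * ?c"
    using assms by (simp add: oscillator_def area_eq algebra_simps)
  have cycle: "?x k = \<rho> * (-1) ^ k" for k
  proof (induction k)
    case (Suc k)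
    have "\<bar>?x k\<bar> = \<rho>" using Suc assms by (simp add: abs_mult power_abs)
    moreover have "oscillator (?x k) = (-1) ^ k * oscillator \<rho>"
      unfolding Suc by (cases "even k") (simp_all add: oscillator_minus)
    ultimately show ?case
      using Suc m by (simp add: inverse osc)
  qed simp
  have "\<not> ?x \<longlonglongrightarrow> 0"
  proof
    assume "?x \<longlonglongrightarrow> 0"
    then have "(\<lambda>k. \<bar>?x k\<bar>) \<longlonglongrightarrow> 0" by (rule tendsto_rabs_zero)
    then have "(\<lambda>k. \<rho>) \<longlonglongrightarrow> (0::real)"
      using assms by (simp add: cycle abs_mult power_abs)
    then show False using assms LIMSEQ_unique[OF tendsto_const] by fastforce
  qed
  then show ?thesis
    unfolding no_larger_convergence_radius_def
    using newton_setting_oscillator[of \<kappa>] assms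
    by (intro allI impI exI[of _ "ball 0 \<kappa>"] exI[of _ oscillator] exI[of _ ?F'] exI[of _ 0] exI[of _ \<rho>])
      auto
qed

end

section \<open>Newton's method near a zero\<close>

locale newton_problem =
  fixes \<Omega> :: "'a::banach set" and F :: "'a \<Rightarrow> 'b::banach" and F' :: "'a \<Rightarrow> 'a \<Rightarrow>\<^sub>L 'b"
    and xs :: 'a and R \<kappa> :: real and L :: "real \<Rightarrow> real"
  assumes setting: "newton_setting \<Omega> F F' xs R \<kappa> L"
begin

sublocale majorant L R
  using setting by unfold_locales (auto simp: newton_setting_def)

lemma
  shows derivative: "x \<in> \<Omega> \<Longrightarrow> (F has_derivative F' x) (at x)"
    and zero: "F xs = 0"
    and invertible_at_zero: "blinfun_invertible (F' xs)"
    and radius_Lipschitz: "\<tau> \<in> {0..1} \<Longrightarrow> x \<in> ball xs \<kappa> \<Longrightarrow>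
      norm (blinfun_inverse (F' xs) o\<^sub>L (F' x - F' (xs + \<tau> *\<^sub>R (x - xs))))
        \<le> integral {\<tau> * norm (x - xs)..norm (x - xs)} L"
  using setting by (auto simp: newton_setting_def)

text \<open>
  The ball of radius \<open>\<kappa>\<close> is the union of the smaller balls, so it lies in \<open>\<Omega>\<close> too.
\<close>

lemma kappa_properties: "0 < \<kappa>" "\<kappa> \<le> R" "ball xs \<kappa> \<subseteq> \<Omega>"
proof -
  let ?S = "{t \<in> {0..<R}. ball xs t \<subseteq> \<Omega>}"
  have \<kappa>: "\<kappa> = Sup ?S" and "open \<Omega>" "xs \<in> \<Omega>"
    using setting by (auto simp: newton_setting_def)
  then obtain e where e: "0 < e" "ball xs e \<subseteq> \<Omega>"
    using open_contains_ball by blast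
  have bdd: "bdd_above ?S" by (rule bdd_aboveI[of _ R]) auto
  have S: "min e (R / 2) \<in> ?S" using e R_pos by auto
  then show "\<kappa> \<le> R"
    unfolding \<kappa> by (intro cSup_least) auto
  show "0 < \<kappa>"
    using less_le_trans[OF _ cSup_upper[OF S bdd], of 0] e R_pos unfolding \<kappa> by simp
  show "ball xs \<kappa> \<subseteq> \<Omega>"
  proof
    fix x assume "x \<in> ball xs \<kappa>"
    then have "dist xs x < Sup ?S" using \<kappa> by simp
    then obtain t where "t \<in> ?S" "dist xs x < t"
      using less_cSup_iff[of ?S "dist xs x"] bdd S by blast
    then show "x \<in> \<Omega>" by auto
  qed
qed

lemma segment_in_ball:
  assumes "x \<in> ball xs \<kappa>" "\<tau> \<in> {0..1}"
  shows "xs + \<tau> *\<^sub>R (x - xs) \<in> ball xs \<kappa>"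
proof -
  have "\<tau> * norm (x - xs) \<le> norm (x - xs)"
    using assms mult_right_mono[of \<tau> 1 "norm (x - xs)"] by simp
  then show ?thesis
    using assms by (simp add: dist_norm norm_minus_commute)
qed

lemma derivative_variation:
  assumes "x \<in> ball xs \<kappa>" "\<tau> \<in> {0..1}"
  shows "norm (blinfun_inverse (F' xs) o\<^sub>L (F' x - F' (xs + \<tau> *\<^sub>R (x - xs))))
      \<le> mass (norm (x - xs)) - mass (\<tau> * norm (x - xs))"
  using radius_Lipschitz[OF assms(2,1)] mass_diff[of "\<tau> * norm (x - xs)" "norm (x - xs)"]
    assms mult_right_mono[of \<tau> 1 "norm (x - xs)"] kappa_properties
  by (simp add: dist_norm norm_minus_commute)

lemma derivative_near_zero:
  assumes "x \<in> ball xs \<kappa>"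
  shows "norm (blinfun_inverse (F' xs) o\<^sub>L (F' x - F' xs)) \<le> mass (norm (x - xs))"
  using derivative_variation[OF assms, of 0] by simp

lemma has_real_derivative_area_scaled:
  assumes "x \<in> ball xs \<kappa>" "x \<noteq> xs" "\<tau> \<in> {0<..<1}"
  shows "((\<lambda>\<tau>. area (\<tau> * norm (x - xs))) has_real_derivative
      mass (\<tau> * norm (x - xs)) * norm (x - xs)) (at \<tau>)"
proof -
  have "\<tau> * norm (x - xs) < 1 * norm (x - xs)"
    using assms by (intro mult_strict_right_mono) auto
  also have "\<dots> < R"
    using assms kappa_properties by (simp add: dist_norm norm_minus_commute)
  finally have "\<tau> * norm (x - xs) < R" .
  then show ?thesis
    using assms by (intro DERIV_chain2[where f = area] has_real_derivative_area)
      (auto intro!: derivative_eq_intros)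
qed

lemma continuous_on_area_scaled:
  assumes "x \<in> ball xs \<kappa>"
  shows "continuous_on {0..1} (\<lambda>\<tau>. area (\<tau> * norm (x - xs)))"
proof (rule continuous_on_compose2[OF continuous_on_area])
  show "(\<lambda>\<tau>. \<tau> * norm (x - xs)) ` {0..1} \<subseteq> {0..<R}"
  proof clarify
    fix \<tau> :: real assume "\<tau> \<in> {0..1}"
    then show "\<tau> * norm (x - xs) \<in> {0..<R}"
      using assms kappa_properties mult_right_mono[of \<tau> 1 "norm (x - xs)"]
      by (simp add: dist_norm norm_minus_commute)
  qed
qed (intro continuous_intros)

text \<open>
  With \<open>s = norm (x - xs)\<close>, the derivative at parameter \<open>\<tau>\<close> of the segment deviates from \<open>F' x\<close>, after
  composition with \<open>F' xs\<inverse>\<close>, by at most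
  \<open>mass s - mass (\<tau> * s)\<close>.  An antiderivative of \<open>s\<close> times this bound is \<open>\<tau> * s * mass s - area (\<tau> * s)\<close>,
  whose increment over \<open>[0, 1]\<close> is \<open>s * mass s - area s = moment s\<close>.
\<close>

lemma newton_residual:
  assumes x: "x \<in> ball xs \<kappa>"
  shows "norm (blinfun_inverse (F' xs) (F x - F' x (x - xs))) \<le> moment (norm (x - xs))"
proof (cases "x = xs")
  case True
  then show ?thesis by (simp add: zero)
next
  case False
  let ?P = "blinfun_inverse (F' xs)" and ?h = "x - xs" and ?s = "norm (x - xs)"
  let ?\<phi> = "\<lambda>\<tau>. \<tau> * ?s * mass ?s - area (\<tau> * ?s)"
  have s: "0 \<le> ?s" "?s < R"
    using x kappa_properties by (auto simp: dist_norm norm_minus_commute)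
  have "norm (?P (F (xs + ?h) - F xs - F' x ?h)) \<le> ?\<phi> 1 - ?\<phi> 0"
  proof (rule linearization_error[where F' = "\<lambda>x. blinfun_apply (F' x)"
        and \<phi>' = "\<lambda>\<tau>. (mass ?s - mass (\<tau> * ?s)) * ?s"])
    fix \<tau> :: real
    show "(F has_derivative F' (xs + \<tau> *\<^sub>R ?h)) (at (xs + \<tau> *\<^sub>R ?h))" if "\<tau> \<in> {0..1}"
      using segment_in_ball[OF x that] kappa_properties by (intro derivative) auto
    show "(?\<phi> has_real_derivative (mass ?s - mass (\<tau> * ?s)) * ?s) (at \<tau>)" if "\<tau> \<in> {0<..<1}"
      using that x False
      by (auto intro!: derivative_eq_intros has_real_derivative_area_scaled simp: algebra_simps)
    show "norm (?P (F' (xs + \<tau> *\<^sub>R ?h) ?h - F' x ?h)) \<le> (mass ?s - mass (\<tau> * ?s)) * ?s"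
      if "\<tau> \<in> {0<..<1}"
    proof -
      let ?D = "?P o\<^sub>L (F' x - F' (xs + \<tau> *\<^sub>R ?h))"
      have "?P (F' (xs + \<tau> *\<^sub>R ?h) ?h - F' x ?h) = - ?D ?h"
        by (simp add: blinfun.diff_left blinfun.minus_right[symmetric])
      then have "norm (?P (F' (xs + \<tau> *\<^sub>R ?h) ?h - F' x ?h)) = norm (?D ?h)"
        by simp
      also have "\<dots> \<le> norm ?D * ?s" by (rule norm_blinfun)
      also have "\<dots> \<le> (mass ?s - mass (\<tau> * ?s)) * ?s"
        using derivative_variation[OF x, of \<tau>] that by (intro mult_right_mono) auto
      finally show ?thesis .
    qed
  qed (intro continuous_intros continuous_on_area_scaled[OF x])
  also have "?\<phi> 1 - ?\<phi> 0 = moment ?s" using s by (simp add: area_eq)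
  finally show ?thesis by (simp add: zero)
qed

text \<open>
  Here the segment is compared with \<open>F' xs\<close>, so the deviation at parameter \<open>\<tau>\<close> is at most \<open>mass (\<tau> * s)\<close> with
  \<open>s = norm (x - xs)\<close>, and \<open>area (\<tau> * s)\<close> is an antiderivative of \<open>s\<close> times this bound.
\<close>

lemma linear_residual_at_zero:
  assumes x: "x \<in> ball xs \<kappa>"
  shows "norm (blinfun_inverse (F' xs) (F x) - (x - xs)) \<le> area (norm (x - xs))"
proof (cases "x = xs")
  case True
  then show ?thesis by (simp add: zero)
next
  case False
  let ?P = "blinfun_inverse (F' xs)" and ?h = "x - xs" and ?s = "norm (x - xs)"
  let ?\<phi> = "\<lambda>\<tau>. area (\<tau> * ?s)"
  have "norm (?P (F (xs + ?h) - F xs - F' xs ?h)) \<le> ?\<phi> 1 - ?\<phi> 0"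
  proof (rule linearization_error[where F' = "\<lambda>x. blinfun_apply (F' x)"
        and \<phi>' = "\<lambda>\<tau>. mass (\<tau> * ?s) * ?s"])
    fix \<tau> :: real
    show "(F has_derivative F' (xs + \<tau> *\<^sub>R ?h)) (at (xs + \<tau> *\<^sub>R ?h))" if "\<tau> \<in> {0..1}"
      using segment_in_ball[OF x that] kappa_properties by (intro derivative) auto
    show "(?\<phi> has_real_derivative mass (\<tau> * ?s) * ?s) (at \<tau>)" if "\<tau> \<in> {0<..<1}"
      using has_real_derivative_area_scaled that x False by blast
    show "norm (?P (F' (xs + \<tau> *\<^sub>R ?h) ?h - F' xs ?h)) \<le> mass (\<tau> * ?s) * ?s"
      if "\<tau> \<in> {0<..<1}"
    proof -
      let ?D = "?P o\<^sub>L (F' (xs + \<tau> *\<^sub>R ?h) - F' xs)"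
      have "norm (?P (F' (xs + \<tau> *\<^sub>R ?h) ?h - F' xs ?h)) = norm (?D ?h)"
        by (simp add: blinfun.diff_left)
      also have "\<dots> \<le> norm ?D * ?s" by (rule norm_blinfun)
      also have "\<dots> \<le> mass (\<tau> * ?s) * ?s"
        using derivative_near_zero[OF segment_in_ball[OF x, of \<tau>]] that
        by (intro mult_right_mono) auto
      finally show ?thesis .
    qed
  qed (rule continuous_on_area_scaled[OF x])
  then show ?thesis
    by (simp add: zero blinfun.diff_right blinfun_inverse_apply[OF invertible_at_zero])
qed

lemma unique_zero:
  assumes "\<sigma> \<le> \<kappa>" "\<And>t. 0 < t \<Longrightarrow> t < \<sigma> \<Longrightarrow> area t < t"
    and "y \<in> ball xs \<sigma>" "F y = 0"
  shows "y = xs"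
proof (rule ccontr)
  assume "y \<noteq> xs"
  then have "area (norm (y - xs)) < norm (y - xs)"
    using assms by (simp add: dist_norm norm_minus_commute)
  moreover have "norm (y - xs) \<le> area (norm (y - xs))"
    using linear_residual_at_zero[of y] assms by (simp add: dist_norm norm_minus_commute)
  ultimately show False by simp
qed

text \<open>
  Since \<open>F xs = 0\<close>, the new error is \<open>F' x\<inverse>\<close> applied to the error of linearizing \<open>F\<close> at \<open>x\<close>.
\<close>

lemma newton_step_estimate:
  assumes r: "contractive_below r" "r \<le> \<kappa>" and x: "x \<in> ball xs r"
  shows "blinfun_invertible (F' x)"
    and "norm (x - blinfun_inverse (F' x) (F x) - xs) \<le> step (norm (x - xs))"
proof -
  let ?s = "norm (x - xs)"
  have s: "0 \<le> ?s" "?s < r" and x\<kappa>: "x \<in> ball xs \<kappa>"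
    using x r by (auto simp: dist_norm norm_minus_commute)
  have m: "mass ?s < 1"
    using s r by (cases "?s = 0") (auto simp: contractive_below_def)
  note pert = invertible_perturbation[OF invertible_at_zero derivative_near_zero[OF x\<kappa>] m]
  show inv: "blinfun_invertible (F' x)" by (rule pert)
  have "x - blinfun_inverse (F' x) (F x) - xs = - blinfun_inverse (F' x) (F x - F' x (x - xs))"
    by (simp add: blinfun.diff_right blinfun_inverse_apply[OF inv])
  then have "norm (x - blinfun_inverse (F' x) (F x) - xs)
      \<le> norm (blinfun_inverse (F' xs) (F x - F' x (x - xs))) / (1 - mass ?s)"
    using pert(2) by simp
  also have "\<dots> \<le> step ?s"
    unfolding step_def using newton_residual[OF x\<kappa>] m by (intro divide_right_mono) auto
  finally show "norm (x - blinfun_inverse (F' x) (F x) - xs) \<le> step ?s" .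
qed

end

section \<open>Convergence of the Newton sequence\<close>

context newton_problem
begin

context
  fixes r :: real and x0 :: 'a
  assumes r: "contractive_below r" "r \<le> \<kappa>" and x0: "x0 \<in> ball xs r - {xs}"
begin

abbreviation "x \<equiv> newton_seq F F' x0"
abbreviation "t \<equiv> scalar_seq L (norm (x0 - xs))"

lemma t0_range: "norm (x0 - xs) \<in> {0<..<r}"
  using x0 by (auto simp: dist_norm norm_minus_commute)

lemmas t_range = scalar_seq_range[OF r(1) t0_range]

text \<open>
  Induction works because \<open>step\<close> is monotone: a smaller error leads to a smaller bound on the next error.
\<close>

lemma newton_seq_majorized: "norm (x k - xs) \<le> t k"
proof (induction k)
  case (Suc k)
  have t: "t k \<in> {0<..<r}" by (rule t_range)
  then have "x k \<in> ball xs r" using Suc by (simp add: dist_norm norm_minus_commute)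
  from newton_step_estimate(2)[OF r this]
  have "norm (x (Suc k) - xs) \<le> step (norm (x k - xs))" by simp
  also have "\<dots> \<le> step (t k)"
    using Suc t r by (intro step_mono) (auto simp: contractive_below_def)
  finally show ?case by (simp only: scalar_seq_Suc)
qed simp

lemma newton_seq_in_ball: "x k \<in> ball xs r"
  using newton_seq_majorized[of k] t_range[of k] by (simp add: dist_norm norm_minus_commute)

lemma newton_seq_step: "norm (x (Suc k) - xs) \<le> step (norm (x k - xs))"
  using newton_step_estimate(2)[OF r newton_seq_in_ball[of k]] by simp

lemma newton_seq_well_defined: "newton_well_defined \<Omega> F F' x0"
  unfolding newton_well_defined_def
proof (intro allI conjI)
  fix k
  show "x k \<in> \<Omega>"
    using newton_seq_in_ball[of k] r(2) kappa_properties(3) by auto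
  show "blinfun_invertible (F' (x k))"
    by (rule newton_step_estimate(1)[OF r newton_seq_in_ball])
qed

lemma error_tendsto_0: "(\<lambda>k. norm (x k - xs)) \<longlonglongrightarrow> 0"
proof (rule tendsto_sandwich[OF _ _ tendsto_const])
  show "\<forall>\<^sub>F k in sequentially. norm (x k - xs) \<le> t k"
    using newton_seq_majorized by (intro always_eventually) blast
  show "t \<longlonglongrightarrow> 0" by (rule scalar_seq_tendsto_0[OF r(1) t0_range])
qed simp

lemma newton_seq_converges: "x \<longlonglongrightarrow> xs"
  by (rule LIM_zero_cancel[OF tendsto_norm_zero_cancel[OF error_tendsto_0]])

lemma error_range: "norm (x k - xs) \<in> {0..<R}" "norm (x k - xs) < r" "mass (norm (x k - xs)) < 1"
proof -
  show s: "norm (x k - xs) < r"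
    using newton_seq_in_ball[of k] by (simp add: dist_norm norm_minus_commute)
  then show "norm (x k - xs) \<in> {0..<R}" using r by (simp add: contractive_below_def)
  show "mass (norm (x k - xs)) < 1"
    using s r by (cases "x k = xs") (auto simp: contractive_below_def)
qed

lemma newton_seq_superlinear: "(\<lambda>k. norm (x (Suc k) - xs) / norm (x k - xs)) \<longlonglongrightarrow> 0"
proof (rule tendsto_sandwich[OF _ _ tendsto_const])
  let ?s = "\<lambda>k. norm (x k - xs)"
  show "\<forall>\<^sub>F k in sequentially. 0 \<le> ?s (Suc k) / ?s k"
    by (intro always_eventually allI divide_nonneg_nonneg norm_ge_zero)
  have "?s (Suc k) / ?s k \<le> mass (?s k) / (1 - mass (?s k))" for k
  proof (cases "?s k = 0")
    case True
    then show ?thesis using R_pos by simp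
  next
    case False
    then show ?thesis
      using newton_seq_step[of k] step_le[of "?s k"] error_range[of k]
      by (simp add: pos_divide_le_eq del: newton_seq.simps)
  qed
  then show "\<forall>\<^sub>F k in sequentially. ?s (Suc k) / ?s k \<le> mass (?s k) / (1 - mass (?s k))"
    by (intro always_eventually) blast
  show "(\<lambda>k. mass (?s k) / (1 - mass (?s k))) \<longlonglongrightarrow> 0"
    by (intro contraction_factor_tendsto_0 error_tendsto_0 error_range)
qed

context
  fixes \<nu> p :: real
  assumes mono: "mono_on {0<..<\<nu>} (\<lambda>t. t powr (1 - p) * L t)" and \<nu>: "r \<le> \<nu>" "\<nu> \<le> R"
begin

lemma scalar_rate_strict_decreasing:
  "t (Suc (Suc k)) / t (Suc k) powr (p + 1) < t (Suc k) / t k powr (p + 1)"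
proof -
  have "step (t (Suc k)) / t (Suc k) powr (p + 1) < step (t k) / t k powr (p + 1)"
    using t_range[of "Suc k"] t_range[of k] scalar_seq_decreasing[OF r(1) t0_range, of k] \<nu> r
    by (intro step_ratio_strict_mono[OF mono]) (auto simp: contractive_below_def simp del: scalar_seq.simps)
  then show ?thesis by (simp only: scalar_seq_Suc)
qed

text \<open>
  The error is at most \<open>t k\<close>, and the ratio \<open>step s / s powr (p + 1)\<close> increases with \<open>s\<close>, so its value at
  the error may be replaced by its value at \<open>t k\<close>.
\<close>

lemma newton_rate:
  "norm (x (Suc k) - xs) \<le> t (Suc k) / t k powr (p + 1) * norm (x k - xs) powr (p + 1)"
proof (cases "x k = xs")
  case True
  then show ?thesis by (simp add: zero)
next
  case False
  let ?s = "norm (x k - xs)"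
  have s: "0 < ?s" "?s \<le> t k" using False newton_seq_majorized by auto
  have t: "0 < t k" "t k < r" "mass (t k) < 1"
    using t_range[of k] r by (auto simp: contractive_below_def)
  have "step ?s / ?s powr (p + 1) \<le> step (t k) / t k powr (p + 1)"
  proof (cases "?s = t k")
    case False
    then show ?thesis
      using s t \<nu>(1) by (intro less_imp_le[OF step_ratio_strict_mono[OF mono \<nu>(2)]]) auto
  qed simp
  then have "step ?s \<le> step (t k) / t k powr (p + 1) * ?s powr (p + 1)"
    using s by (simp add: pos_divide_le_eq)
  with newton_seq_step[of k] show ?thesis
    unfolding scalar_seq_Suc by linarith
qed

end

end

end

section \<open>The convergence theorem\<close>

theorem theorem14:
  fixes \<Omega> :: "'a::banach set"
    and F :: "'a \<Rightarrow> 'b::banach"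
    and F' :: "'a \<Rightarrow> 'a \<Rightarrow>\<^sub>L 'b"
    and xs :: 'a
    and L :: "real \<Rightarrow> real"
    and R \<kappa> \<nu> \<rho> r \<sigma> :: real
  assumes setting: "newton_setting \<Omega> F F' xs R \<kappa> L"
    and nu: "\<nu> = Sup {t \<in> {0..<R}. integral {0..t} L - 1 < 0}"
    and rho: "\<rho> = Sup {\<delta> \<in> {0<..<\<nu>}. \<forall>t\<in>{0<..<\<delta>}.
               integral {0..t} (\<lambda>u. L u * u) / (t * (1 - integral {0..t} L)) < 1}"
    and r: "r = min \<kappa> \<rho>"
    and sigma: "\<sigma> = Sup {t \<in> {0<..<\<kappa>}. integral {0..t} (\<lambda>u. L u * (t - u)) - t < 0}"
  shows "\<nu> > 0 \<and> \<rho> > 0 \<and> r > 0 \<and>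
    (\<forall>x0 \<in> ball xs r - {xs}.
       let x = newton_seq F F' x0; t = scalar_seq L (norm (x0 - xs)) in
         newton_well_defined \<Omega> F F' x0 \<and>
         scalar_well_defined R L (norm (x0 - xs)) \<and>
         (\<forall>k. t (Suc k) < t k) \<and>
         (\<forall>k. t k \<in> {0<..<r}) \<and>
         t \<longlonglongrightarrow> 0 \<and>
         (\<forall>k. x k \<in> ball xs r) \<and>
         x \<longlonglongrightarrow> xs \<and>
         (\<lambda>k. t (Suc k) / t k) \<longlonglongrightarrow> 0 \<and>
         (\<lambda>k. norm (x (Suc k) - xs) / norm (x k - xs)) \<longlonglongrightarrow> 0) \<and>
    {y \<in> ball xs \<sigma>. F y = 0} = {xs} \<and>
    (integral {0..\<rho>} (\<lambda>u. L u * u) / (\<rho> * (1 - integral {0..\<rho>} L)) = 1 \<and> \<rho> < \<kappa> \<longrightarrow>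
       r = \<rho> \<and> no_larger_convergence_radius R \<kappa> L \<rho>) \<and>
    (\<forall>p\<in>{0..1}. mono_on {0<..<\<nu>} (\<lambda>t. t powr (1 - p) * L t) \<longrightarrow>
       (\<forall>x0 \<in> ball xs r - {xs}.
          let x = newton_seq F F' x0; t = scalar_seq L (norm (x0 - xs)) in
            (\<forall>k. t (Suc (Suc k)) / t (Suc k) powr (p + 1) < t (Suc k) / t k powr (p + 1)) \<and>
            (\<forall>k. norm (x (Suc k) - xs)
                   \<le> t (Suc k) / t k powr (p + 1) * norm (x k - xs) powr (p + 1))))"
proof -
  interpret newton_problem \<Omega> F F' xs R \<kappa> L by unfold_locales (rule setting)
  note folds = mass_def[symmetric] moment_def[symmetric] area_def[symmetric]
  have nu': "\<nu> = Sup {t \<in> {0..<R}. mass t - 1 < 0}"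
    using nu by (simp only: folds)
  note nu_props = nu_properties[OF nu']
  have "\<rho> = Sup {\<delta> \<in> {0<..<\<nu>}. \<forall>t\<in>{0<..<\<delta>}. moment t / (t * (1 - mass t)) < 1}"
    using rho by (simp only: folds)
  note rho_props = rho_properties[OF nu' this]
  have "\<sigma> = Sup {t \<in> {0<..<\<kappa>}. area t - t < 0}"
    using sigma by (simp only: folds)
  note sigma_props = area_less_below_sigma[OF kappa_properties(2,1) this]
  have r_contr: "contractive_below r" and r_le: "r \<le> \<kappa>" "r \<le> \<nu>" and r_pos: "0 < r"
    using contractive_below_mono[OF rho_props(3)] r rho_props kappa_properties by auto
  have zeros: "{y \<in> ball xs \<sigma>. F y = 0} = {xs}"
    using unique_zero[OF sigma_props(2,3)] sigma_props(1) zero by auto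
  have sharp: "r = \<rho> \<and> no_larger_convergence_radius R \<kappa> L \<rho>"
    if "moment \<rho> / (\<rho> * (1 - mass \<rho>)) = 1" "\<rho> < \<kappa>"
  proof -
    have "step \<rho> = \<rho>"
      using that rho_props(1) by (simp add: step_def field_simps)
    then show ?thesis
      using two_cycle_at_fixed_point[OF rho_props(1)] that r kappa_properties by simp
  qed
  show ?thesis
    unfolding Let_def folds
  proof (intro conjI ballI)
    fix x0 assume x0: "x0 \<in> ball xs r - {xs}"
    note assms_x = r_contr r_le(1) x0
    note assms_t = r_contr t0_range[OF assms_x]
    show "newton_well_defined \<Omega> F F' x0"
      by (rule newton_seq_well_defined[OF assms_x])
    show "scalar_well_defined R L (norm (x0 - xs))"
      by (rule scalar_seq_well_defined[OF assms_t])
    show "\<forall>k. scalar_seq L (norm (x0 - xs)) (Suc k) < scalar_seq L (norm (x0 - xs)) k"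
      by (intro allI scalar_seq_decreasing[OF assms_t])
    show "\<forall>k. scalar_seq L (norm (x0 - xs)) k \<in> {0<..<r}"
      by (intro allI scalar_seq_range[OF assms_t])
    show "scalar_seq L (norm (x0 - xs)) \<longlonglongrightarrow> 0"
      by (rule scalar_seq_tendsto_0[OF assms_t])
    show "\<forall>k. newton_seq F F' x0 k \<in> ball xs r"
      by (intro allI newton_seq_in_ball[OF assms_x])
    show "newton_seq F F' x0 \<longlonglongrightarrow> xs"
      by (rule newton_seq_converges[OF assms_x])
    show "(\<lambda>k. scalar_seq L (norm (x0 - xs)) (Suc k) / scalar_seq L (norm (x0 - xs)) k) \<longlonglongrightarrow> 0"
      by (rule scalar_seq_superlinear[OF assms_t])
    show "(\<lambda>k. norm (newton_seq F F' x0 (Suc k) - xs) / norm (newton_seq F F' x0 k - xs)) \<longlonglongrightarrow> 0"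
      by (rule newton_seq_superlinear[OF assms_x])
  next
    fix p :: real
    show "mono_on {0<..<\<nu>} (\<lambda>t. t powr (1 - p) * L t) \<longrightarrow>
       (\<forall>x0 \<in> ball xs r - {xs}.
          (\<forall>k. scalar_seq L (norm (x0 - xs)) (Suc (Suc k)) / scalar_seq L (norm (x0 - xs)) (Suc k) powr (p + 1)
             < scalar_seq L (norm (x0 - xs)) (Suc k) / scalar_seq L (norm (x0 - xs)) k powr (p + 1)) \<and>
          (\<forall>k. norm (newton_seq F F' x0 (Suc k) - xs)
             \<le> scalar_seq L (norm (x0 - xs)) (Suc k) / scalar_seq L (norm (x0 - xs)) k powr (p + 1)
                * norm (newton_seq F F' x0 k - xs) powr (p + 1)))"
    proof (intro impI ballI conjI allI)
      fix x0 k
      assume mono: "mono_on {0<..<\<nu>} (\<lambda>t. t powr (1 - p) * L t)" and x0: "x0 \<in> ball xs r - {xs}"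
      note assms_p = r_contr r_le(1) x0 mono r_le(2) nu_props(2)
      show "scalar_seq L (norm (x0 - xs)) (Suc (Suc k)) / scalar_seq L (norm (x0 - xs)) (Suc k) powr (p + 1)
          < scalar_seq L (norm (x0 - xs)) (Suc k) / scalar_seq L (norm (x0 - xs)) k powr (p + 1)"
        by (rule scalar_rate_strict_decreasing[OF assms_p])
      show "norm (newton_seq F F' x0 (Suc k) - xs)
          \<le> scalar_seq L (norm (x0 - xs)) (Suc k) / scalar_seq L (norm (x0 - xs)) k powr (p + 1)
             * norm (newton_seq F F' x0 k - xs) powr (p + 1)"
        by (rule newton_rate[OF assms_p])
    qed
  qed (use nu_props(1) rho_props(1) r_pos zeros sharp in blast)+
qed

end
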